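(* Let $0<\gamma<\gamma'<1/3$. For every $T\in\mathcal{C}_{\gamma,\gamma'}$ there exists a staircase rank one transformation $S\in\mathcal{C}_{\gamma/3,3\gamma'}$ such that $(T,S)\in\mathcal{L}^{\gamma/3,3\gamma',\gamma/4}$.
   Context: **Rank one systems.** Fix a sequence of cuts $(p_n)_{n\in\mathbb{N}}$ of integers with $p_n>1$ for all $n$ and spacers $(a_{n,i})_{i=1}^{p_n}$, $n\in\mathbb{N}=\{1,2,\dots\}$ (nonnegative integers). Heights: $h_1=1$ and $h_n=p_{n-1}h_{n-1}+\sum_{i=1}^{p_{n-1}}a_{n-1,i}$. The rank one transformation $T$ is built by cutting and stacking: $\mathcal{T}_1=[0,1]$ is a tower with one level. At stage $n$, the tower $\mathcal{T}_n$ ($h_n$ levels, which are intervals of equal width; $T$ maps each level but the last to the level just above it by translation) is cut into $p_n$ subtowers of equal width; over the $i$-th subtower one puts $a_{n,i}$ spacers (new disjoint intervals of the same width as the levels of the subtower), and then the subtowers with their spacers are stacked, each on top of the previous one, to obtain $\mathcal{T}_{n+1}$, which has $h_{n+1}$ levels. $T$ is then defined almost everywhere on $\mathcal{T}_\infty=\bigcup_n\mathcal{T}_n$. It is assumed that $\sum_{n\ge1}\frac{1}{\prod_{k=1}^n p_k}\bigl(\sum_{i=1}^{p_n}a_{n,i}\bigr)<+\infty$, so that $T$ preserves the probability measure $\mu_T$ given by normalized Lebesgue measure on $\mathcal{T}_\infty$. The set of such transformations is denoted $Rank(1)$. A superscript $T$ ($p_n^T,a_{n,i}^T,h_n^T$)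 indicates the transformation. **Staircase.** $S\in Rank(1)$ is a staircase rank one transformation if $a^S_{n,i}=i$ for all $n\in\mathbb{N}$ and $i\in\{1,\dots,p_n^S\}$. **The class $\mathcal{C}_{\gamma,\gamma'}$.** For $0<\gamma<\gamma'<1$, $\mathcal{C}_{\gamma,\gamma'}$ is the set of $T\in Rank(1)$ for which there is $n'_T\in\mathbb{N}$ such that for every $n\ge n'_T$: $p_n^T\in[(h_n^T)^\gamma,(h_n^T)^{\gamma'})$, $a_{n,i}^T>a_{n,i-1}^T$ for $i=2,\dots,p_n^T$, and $a^T_{n,p_n^T}\le (h_n^T)^{\gamma'}$. **Alternating sequences.** For $\delta>0$ and increasing sequences of positive integers $(a_n),(b_n)$, $(b_n)$ is $(a_n)$-alternating with exponent $\delta$ if there is $n_0$ such that for every $n\ge n_0$, if $m(n)$ is the unique index with $b_{m(n)}\le a_n<b_{m(n)+1}$, then $b_{m(n)}^{1+\delta}<a_n$ and $a_n^{1+\delta}<b_{m(n)+1}$. The sequences are $\delta$-alternating if $(a_n)$ is $(b_n)$-alternating with exponent $\delta$ and $(b_n)$ is $(a_n)$-alternating with exponent $\delta$. **The class $\mathcal{L}^{\gamma,\gamma',\delta}$.** $\mathcal{L}^{\gamma,\gamma',\delta}$ is the set of pairs $(T,S)\in\mathcal{C}_{\gamma,\gamma'}\times\mathcal{C}_{\gamma,\gamma'}$ such that $(h_n^T)$ and $(h_n^S)$ are $\delta$-alternating. *)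

theory Defs
  imports Complex_Main
begin

text \<open>
  A rank one transformation is carried together with the cutting and stacking parameters that
  produce it, since the classes below refer to those parameters.  All sequences are indexed by
  \<open>n \<ge> 1\<close>, and the spacers of stage \<open>n\<close> by \<open>1 \<le> i \<le> cuts T n\<close>; other values are irrelevant.
\<close>

record rank_one =
  cuts :: "nat \<Rightarrow> nat"
  spacers :: "nat \<Rightarrow> nat \<Rightarrow> nat"
  transf :: "real \<Rightarrow> real"

text \<open>In the recursive definitions below the value at stage \<open>0\<close> is a dummy.\<close>

fun height :: "rank_one \<Rightarrow> nat \<Rightarrow> nat" where
  "height T 0 = 1"
| "height T (Suc 0) = 1"
| "height T (Suc (Suc n)) =
     cuts T (Suc n) * height T (Suc n) + (\<Sum>i=1..cuts T (Suc n). spacers T (Suc n) i)"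

definition width :: "rank_one \<Rightarrow> nat \<Rightarrow> real" where
  "width T n = 1 / (\<Prod>k=1..<n. real (cuts T k))"

text \<open>
  The new spacers are placed from left to right directly after the intervals already used, so
  that the \<open>n\<close>-th tower occupies \<open>[0, h\<^sub>n w\<^sub>n)\<close>, where \<open>h\<^sub>n\<close> is the height and \<open>w\<^sub>n\<close> the width of
  its levels.  The list \<open>tower T n\<close> enumerates the levels from bottom to top, the entry \<open>k\<close>
  standing for the interval \<open>[k w\<^sub>n, (k+1) w\<^sub>n)\<close>.  Cutting this interval into \<open>p\<^sub>n\<close> pieces gives the
  intervals with numbers \<open>k p\<^sub>n + (i - 1)\<close>, \<open>1 \<le> i \<le> p\<^sub>n\<close>, of width \<open>w\<^sub>n / p\<^sub>n\<close>; the spacers get the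
  numbers from \<open>h\<^sub>n p\<^sub>n\<close> on.  Half-open intervals are used in order to have disjoint levels.
\<close>

fun tower :: "rank_one \<Rightarrow> nat \<Rightarrow> nat list" where
  "tower T 0 = [0]"
| "tower T (Suc 0) = [0]"
| "tower T (Suc (Suc n)) =
     (let p = cuts T (Suc n); a = spacers T (Suc n); h = height T (Suc n) in
      concat (map (\<lambda>i. map (\<lambda>k. k * p + (i - 1)) (tower T (Suc n)) @
                        [h * p + (\<Sum>i'=1..<i. a i') ..< h * p + (\<Sum>i'=1..i. a i')])
                  [1..<p + 1]))"

definition left_end :: "rank_one \<Rightarrow> nat \<Rightarrow> nat \<Rightarrow> real" where
  "left_end T n j = real (tower T n ! j) * width T n"

definition level :: "rank_one \<Rightarrow> nat \<Rightarrow> nat \<Rightarrow> real set" where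
  "level T n j = {left_end T n j ..< left_end T n j + width T n}"

text \<open>
  The last conjunct says that the transformation maps every level but the last of every tower
  to the level above it by translation.  Its values outside the union of all towers are irrelevant.
  The summability condition is that the union of all towers has finite measure.
\<close>

definition Rank1 :: "rank_one set" where
  "Rank1 = {T.
     (\<forall>n\<ge>1. cuts T n > 1) \<and>
     summable (\<lambda>n. 1 / (\<Prod>k=1..Suc n. real (cuts T k)) *
                     (\<Sum>i=1..cuts T (Suc n). real (spacers T (Suc n) i))) \<and>
     (\<forall>n\<ge>1. \<forall>j. Suc j < height T n \<longrightarrow>
        (\<forall>x\<in>level T n j. transf T x = x + (left_end T n (Suc j) - left_end T n j)))}"

definition staircase :: "rank_one \<Rightarrow> bool" where
  "staircase S \<longleftrightarrow> S \<in> Rank1 \<and> (\<forall>n\<ge>1. \<forall>i\<in>{1..cuts S n}. spacers S n i = i)"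

definition class_C :: "real \<Rightarrow> real \<Rightarrow> rank_one set" where
  "class_C \<gamma> \<gamma>' = {T \<in> Rank1. \<exists>n'\<ge>1. \<forall>n\<ge>n'.
     real (cuts T n) \<in> {real (height T n) powr \<gamma> ..< real (height T n) powr \<gamma>'} \<and>
     (\<forall>i\<in>{2..cuts T n}. spacers T n i > spacers T n (i - 1)) \<and>
     real (spacers T n (cuts T n)) \<le> real (height T n) powr \<gamma>'}"

text \<open>
  Sequences are again indexed by \<open>n \<ge> 1\<close>.  In \<open>alternating_to a b \<delta>\<close> the sequence \<open>b\<close> is
  \<open>a\<close>-alternating with exponent \<open>\<delta>\<close>; the index \<open>m\<close> is unique because \<open>b\<close> is increasing.
\<close>

definition increasing_pos :: "(nat \<Rightarrow> nat) \<Rightarrow> bool" where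
  "increasing_pos a \<longleftrightarrow> (\<forall>n\<ge>1. 0 < a n) \<and> strict_mono_on {1..} a"

definition alternating_to :: "(nat \<Rightarrow> nat) \<Rightarrow> (nat \<Rightarrow> nat) \<Rightarrow> real \<Rightarrow> bool" where
  "alternating_to a b \<delta> \<longleftrightarrow> increasing_pos a \<and> increasing_pos b \<and>
     (\<exists>n\<^sub>0\<ge>1. \<forall>n\<ge>n\<^sub>0. \<exists>m\<ge>1. b m \<le> a n \<and> a n < b (m + 1) \<and>
        real (b m) powr (1 + \<delta>) < real (a n) \<and>
        real (a n) powr (1 + \<delta>) < real (b (m + 1)))"

definition alternating :: "real \<Rightarrow> (nat \<Rightarrow> nat) \<Rightarrow> (nat \<Rightarrow> nat) \<Rightarrow> bool" where
  "alternating \<delta> a b \<longleftrightarrow> alternating_to b a \<delta> \<and> alternating_to a b \<delta>"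

definition class_L :: "real \<Rightarrow> real \<Rightarrow> real \<Rightarrow> (rank_one \<times> rank_one) set" where
  "class_L \<gamma> \<gamma>' \<delta> = {(T, S) \<in> class_C \<gamma> \<gamma>' \<times> class_C \<gamma> \<gamma>'.
     alternating \<delta> (height T) (height S)}"


lemma length_tower: "length (tower T n) = height T n"
proof (induction T n rule: height.induct)
  case (3 T n)
  have *: "(\<Sum>i'=1..i. f i') = (\<Sum>i'=1..<i. f i') + f i" if "i \<ge> 1" for i and f :: "nat \<Rightarrow> nat"
    using that by (cases i) (simp_all add: atLeastLessThanSuc_atLeastAtMost)
  have "(\<Sum>i\<in>{1..<p+1}. length (tower T (Suc n)) + ((\<Sum>i'=1..i. f i') - (\<Sum>i'=1..<i. f i')))
       = (\<Sum>i=1..p. height T (Suc n) + f i)" for p and f :: "nat \<Rightarrow> nat"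
  proof (rule sum.cong)
    show "{1..<p+1} = {1..p}" by auto
    fix i assume "i \<in> {1..p}"
    then show "length (tower T (Suc n)) + ((\<Sum>i'=1..i. f i') - (\<Sum>i'=1..<i. f i')) = height T (Suc n) + f i"
      using 3 *[of i f] by simp
  qed
  then show ?case
    by (simp add: Let_def length_concat o_def interv_sum_list_conv_sum_set_nat sum.distrib del: upt_Suc)
qed auto

lemma set_tower:
  assumes "\<forall>n\<ge>1. cuts T n > 1"
  shows "{..<height T n} \<subseteq> set (tower T n)"
  using assms
proof (induction T n rule: height.induct)
  case (3 T n)
  define p a h where "p = cuts T (Suc n)" and "a = spacers T (Suc n)" and "h = height T (Suc n)"
  have p: "p > 1" using 3 by (auto simp: p_def)
  have IH: "{..<h} \<subseteq> set (tower T (Suc n))" using 3 by (auto simp: h_def)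
  have set_eq: "set (tower T (Suc (Suc n))) = (\<Union>i\<in>{1..p}. (\<lambda>k. k * p + (i - 1)) ` set (tower T (Suc n)) \<union>
      {h * p + sum a {1..<i} ..< h * p + sum a {1..i}})"
    by (simp add: Let_def p_def a_def h_def atLeastLessThanSuc_atLeastAtMost del: upt_Suc)
  show ?case
  proof
    fix k assume "k \<in> {..<height T (Suc (Suc n))}"
    then have k: "k < h * p + sum a {1..p}" by (simp add: p_def a_def h_def mult.commute)
    show "k \<in> set (tower T (Suc (Suc n)))"
    proof (cases "k < h * p")
      case True
      then have "k div p \<in> set (tower T (Suc n))" using IH p
        by (auto simp: less_mult_imp_div_less)
      moreover have "k = (k div p) * p + (Suc (k mod p) - 1)" by simp
      moreover have "Suc (k mod p) \<in> {1..p}" using p by (simp add: Suc_le_eq)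
      ultimately show ?thesis unfolding set_eq by blast
    next
      case False
      define i where "i = (LEAST i. k < h * p + sum a {1..i})"
      have i1: "k < h * p + sum a {1..i}" unfolding i_def by (rule LeastI[of _ p]) (rule k)
      have ip: "i \<le> p" unfolding i_def by (rule Least_le) (rule k)
      have i0: "i \<noteq> 0" using i1 False by (auto intro: ccontr)
      have "\<not> k < h * p + sum a {1..i-1}" using i0 unfolding i_def
        by (intro not_less_Least) simp
      moreover have "{1..i-1} = {1..<i}" using i0 by auto
      ultimately show ?thesis unfolding set_eq using i0 i1 ip by (auto intro!: bexI[of _ i])
    qed
  qed
qed auto

lemma distinct_tower: 
  assumes "\<forall>n\<ge>1. cuts T n > 1"
  shows "distinct (tower T n)"
proof -
  have "height T n \<le> card (set (tower T n))"
    using card_mono[OF _ set_tower[OF assms, of n]] by simp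
  then show ?thesis
    by (metis card_distinct card_length length_tower le_antisym)
qed

lemma width_pos: "(\<forall>n\<ge>1. cuts T n > 1) \<Longrightarrow> width T n > 0"
  unfolding width_def by (force intro!: prod_pos divide_pos_pos)

lemma level_disjoint:
  assumes "\<forall>n\<ge>1. cuts T n > 1" "j < height T n" "k < height T n" "x \<in> level T n j" "x \<in> level T n k"
  shows "j = k"
proof -
  have w: "width T n > 0" using width_pos assms(1) .
  have "\<lfloor>x / width T n\<rfloor> = int (tower T n ! i)" if "x \<in> level T n i" for i
    using that w by (auto simp: level_def left_end_def floor_eq_iff field_simps)
  from this[OF assms(4)] this[OF assms(5)] have "tower T n ! j = tower T n ! k" by simp
  then show ?thesis using distinct_tower[OF assms(1)] assms
    by (simp add: nth_eq_iff_index_eq length_tower)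
qed

lemma level_refine:
  assumes c: "\<forall>n\<ge>1. cuts T n > 1" and "n \<ge> 1" and j: "Suc j < height T n" and x: "x \<in> level T n j"
  obtains j' where "Suc j' < height T (Suc n)" "x \<in> level T (Suc n) j'"
    "left_end T (Suc n) (Suc j') - left_end T (Suc n) j' = left_end T n (Suc j) - left_end T n j"
proof -
  obtain m where n: "n = Suc m" using \<open>n \<ge> 1\<close> by (cases n) auto
  define p where "p = cuts T n"
  have p: "p > 1" using c assms(2) by (auto simp: p_def)
  define w where "w = width T (Suc n)"
  have w: "w > 0" using width_pos c by (auto simp: w_def)
  have wn: "width T n = real p * w" using p \<open>n \<ge> 1\<close> by (simp add: w_def width_def p_def)
  define l where "l = tower T n ! j"
  have x': "real l * (p * w) \<le> x" "x < (real l + 1) * (p * w)"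
    using x by (auto simp: level_def left_end_def wn l_def algebra_simps)
  define q where "q = nat \<lfloor>x / w\<rfloor>"
  have x0: "0 \<le> x" using w by (intro order_trans[OF _ x'(1)]) simp
  have "0 \<le> x / w" using x0 w by simp
  then have "real q \<le> x / w" "x / w < real q + 1" by (simp_all add: q_def)
  then have q: "real q * w \<le> x" "x < (real q + 1) * w"
    using w by (simp_all add: pos_le_divide_eq pos_divide_less_eq)
  have "real l * p * w < (real q + 1) * w" using x'(1) q(2) by (simp add: mult.assoc)
  then have "real (l * p) < real (q + 1)" using w by simp
  then have q1: "l * p \<le> q" by linarith
  have "real q * w < (real l + 1) * p * w" using x'(2) q(1) by (simp add: mult.assoc)
  then have "real q * w < real ((l + 1) * p) * w" by (simp add: algebra_simps)
  then have "real q < real ((l + 1) * p)" using w by (simp only: mult_less_cancel_right_pos)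
  then have q2: "q < (l + 1) * p" by linarith
  define i where "i = q - l * p + 1"
  have i: "1 \<le> i" "i < p + 1" "q = l * p + (i - 1)" using q1 q2 by (auto simp: i_def)
  define M where "M = (\<lambda>i. map (\<lambda>k. k * p + (i - 1)) (tower T n))"
  have "[1..<p+1] = [1..<i] @ [i..<p+1]" using i upt_add_eq_append[of 1 i "p + 1 - i"] by simp
  also have "[i..<p+1] = i # [Suc i..<p+1]" using i by (intro upt_conv_Cons) auto
  finally have "[1..<p+1] = [1..<i] @ i # [Suc i..<p+1]" .
  then obtain A B where AB: "tower T (Suc n) = A @ M i @ B"
    unfolding n tower.simps Let_def by (simp add: M_def p_def n del: upt_Suc)
  define j' where "j' = length A + j"
  have lM: "length (M i) = height T n" by (simp add: M_def length_tower)
  have "length (tower T (Suc n)) = length A + height T n + length B" by (simp add: AB lM)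
  then have 1: "Suc j' < height T (Suc n)" using j by (simp add: length_tower j'_def)
  have 2: "tower T (Suc n) ! j' = q" using j i
    by (simp add: AB j'_def nth_append lM) (simp add: M_def l_def length_tower)
  have 3: "tower T (Suc n) ! Suc j' = (tower T n ! Suc j) * p + (i - 1)" using j i
    by (simp add: AB j'_def nth_append lM) (simp add: M_def length_tower)
  show ?thesis
  proof (rule that[OF 1])
    show "x \<in> level T (Suc n) j'" using q by (simp add: level_def left_end_def 2 w_def algebra_simps)
    show "left_end T (Suc n) (Suc j') - left_end T (Suc n) j' = left_end T n (Suc j) - left_end T n j"
      unfolding left_end_def 2 3 wn unfolding i(3) l_def[symmetric] w_def[symmetric]
      by (simp add: algebra_simps)
  qed
qed

lemma level_refine_le:
  assumes c: "\<forall>n\<ge>1. cuts T n > 1" and "n \<ge> 1" and j: "Suc j < height T n" and x: "x \<in> level T n j"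
  shows "\<exists>j'. Suc j' < height T (n + d) \<and> x \<in> level T (n + d) j' \<and>
    left_end T (n + d) (Suc j') - left_end T (n + d) j' = left_end T n (Suc j) - left_end T n j"
proof (induction d)
  case 0 then show ?case using assms by auto
next
  case (Suc d)
  then obtain j' where j': "Suc j' < height T (n + d)" "x \<in> level T (n + d) j'"
    "left_end T (n + d) (Suc j') - left_end T (n + d) j' = left_end T n (Suc j) - left_end T n j" by blast
  have "1 \<le> n + d" using \<open>n \<ge> 1\<close> by simp
  from level_refine[OF c this j'(1,2)] show ?case using j'(3) by (metis add_Suc_right)
qed

lemma shift_unique:
  assumes c: "\<forall>n\<ge>1. cuts T n > 1" and n: "n \<ge> 1" "Suc j < height T n" "x \<in> level T n j"
    and m: "m \<ge> 1" "Suc k < height T m" "x \<in> level T m k"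
  shows "left_end T n (Suc j) - left_end T n j = left_end T m (Suc k) - left_end T m k"
proof -
  obtain j' where "Suc j' < height T (n + m)" "x \<in> level T (n + m) j'"
    "left_end T (n + m) (Suc j') - left_end T (n + m) j' = left_end T n (Suc j) - left_end T n j"
    using level_refine_le[OF c n, of m] by blast
  moreover obtain k' where "Suc k' < height T (n + m)" "x \<in> level T (n + m) k'"
    "left_end T (n + m) (Suc k') - left_end T (n + m) k' = left_end T m (Suc k) - left_end T m k"
    using level_refine_le[OF c m, of n] unfolding add.commute[of m n] by blast
  moreover from calculation have "j' = k'"
    by (intro level_disjoint[OF c, of j' "n + m" k' x]) auto
  ultimately show ?thesis by simp
qed

text \<open>The transformation required in \<open>Rank1\<close> exists for all cuts and spacers.\<close>

lemma rank_one_transf_exists: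
  assumes c: "\<forall>n\<ge>1. cuts T n > 1"
  shows "\<exists>f. \<forall>n\<ge>1. \<forall>j. Suc j < height T n \<longrightarrow>
    (\<forall>x\<in>level T n j. f x = x + (left_end T n (Suc j) - left_end T n j))"
proof -
  define P where "P x s \<longleftrightarrow> (\<exists>n\<ge>1. \<exists>j. Suc j < height T n \<and> x \<in> level T n j \<and>
    s = left_end T n (Suc j) - left_end T n j)" for x s
  have "(THE s. P x s) = left_end T n (Suc j) - left_end T n j"
    if that: "n \<ge> 1" "Suc j < height T n" "x \<in> level T n j" for x n j
  proof (rule the_equality)
    show "P x (left_end T n (Suc j) - left_end T n j)" unfolding P_def using that by blast
    fix s assume "P x s"
    then obtain m k where m: "m \<ge> 1" "Suc k < height T m" "x \<in> level T m k"
      and s: "s = left_end T m (Suc k) - left_end T m k" unfolding P_def by blast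
    show "s = left_end T n (Suc j) - left_end T n j"
      unfolding s by (rule shift_unique[OF c m that])
  qed
  then show ?thesis by (intro exI[of _ "\<lambda>x. x + (THE s. P x s)"]) simp
qed

end

theory Submission
  imports Defs
begin

text \<open>
  Write \<open>h\<^sub>n\<close> for the heights of \<open>T\<close>.  Membership in the class makes \<open>h\<^sub>n\<^sub>+\<^sub>1\<close> lie, up to a factor \<open>2\<close>,
  between \<open>h\<^sub>n\<close> to the powers \<open>1 + \<gamma>\<close> and \<open>1 + \<gamma>'\<close> (\<open>class_C_height_growth\<close>), so between two
  consecutive heights there is room for one more.  The staircase is built so that its heights
  follow the geometric means \<open>sqrt (h\<^sub>n h\<^sub>n\<^sub>+\<^sub>1)\<close> up to a factor \<open>2\<close>.  This is possible with an error
  that does not accumulate: from a height \<open>H\<close>, the possible next heights \<open>p H + p (p + 1) / 2\<close>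
  at most double from one \<open>p \<ge> 2\<close> to the next, so one of them lies within a factor \<open>2\<close> below any
  given target \<open>\<ge> 2 H + 3\<close>, however well or badly \<open>H\<close> met its own target
  (\<open>staircase_heights_near\<close>).  The first stage jumps from height \<open>1\<close> to a
  mean so late that the growth of the heights has set in; the \<open>m\<close>-th height of the staircase thus
  belongs to the mean number \<open>m + d\<close> for a fixed shift \<open>d\<close>.

  The number of cuts is about the quotient of two consecutive heights, hence about
  \<open>sqrt (h\<^sub>n\<^sub>+\<^sub>2 / h\<^sub>n)\<close>, and in logarithms everything becomes a linear inequality in which the
  bounded factors are negligible (\<open>geometric_mean_estimates\<close>).  In particular the number of cuts
  is at most the height to the power \<open>3 \<gamma>' < 1\<close>, so that the relative measure added by the spacers
  decreases geometrically and the total measure is finite (\<open>staircase_with_cuts_exists\<close>).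
\<close>

section \<open>Heights of rank one towers\<close>

lemma height_Suc:
  assumes "n \<ge> 1"
  shows "height T (Suc n) = cuts T n * height T n + (\<Sum>i=1..cuts T n. spacers T n i)"
  using assms by (cases n) simp_all

lemma height_doubles:
  assumes "\<forall>n\<ge>1. cuts T n > 1" and "n \<ge> 1"
  shows "2 * height T n \<le> height T (Suc n)"
proof -
  have "2 \<le> cuts T n" using assms by (simp add: Suc_le_eq numeral_2_eq_2)
  then have "2 * height T n \<le> cuts T n * height T n" by (rule mult_right_mono) simp
  then show ?thesis by (simp only: height_Suc[OF assms(2)] trans_le_add1)
qed

lemma power2_le_height:
  assumes "\<forall>n\<ge>1. cuts T n > 1"
  shows "2 ^ n \<le> height T (Suc n)"
proof (induction n)
  case (Suc n)
  then show ?case using height_doubles[OF assms, of "Suc n"] by simp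
qed simp

lemma height_pos:
  assumes "\<forall>n\<ge>1. cuts T n > 1" and "n \<ge> 1"
  shows "height T n \<ge> 1"
proof -
  have "1 \<le> (2::nat) ^ (n - 1)" by simp
  also have "\<dots> \<le> height T n" using power2_le_height[OF assms(1), of "n - 1"] assms(2) by simp
  finally show ?thesis .
qed

lemma increasing_pos_height:
  assumes "\<forall>n\<ge>1. cuts T n > 1"
  shows "increasing_pos (height T)"
  unfolding increasing_pos_def
proof (intro conjI allI impI)
  show pos: "0 < height T n" if "n \<ge> 1" for n
    using height_pos[OF assms that] by simp
  have step: "height T (Suc k) < height T (Suc (Suc k))" for k
    using height_doubles[OF assms, of "Suc k"] pos[of "Suc k"] by linarith
  show "strict_mono_on {1..} (height T)"
  proof (rule strict_mono_onI)
    fix m n :: nat assume "m \<in> {1..}" "m < n"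
    then show "height T m < height T n"
      using lift_Suc_mono_less[of "\<lambda>k. height T (Suc k)" "m - 1" "n - 1"] step by simp
  qed
qed

lemma filterlim_ln_height:
  assumes "\<forall>n\<ge>1. cuts T n > 1"
  shows "filterlim (\<lambda>n. ln (real (height T n))) at_top sequentially"
proof -
  have le: "n \<le> height T n" if "n \<ge> 1" for n
  proof -
    have "n \<le> 2 ^ (n - 1)" using less_exp[of "n - 1"] that by linarith
    also have "\<dots> \<le> height T n" using power2_le_height[OF assms, of "n - 1"] that by simp
    finally show ?thesis .
  qed
  have "filterlim (\<lambda>n. real (height T n)) at_top sequentially"
    by (rule filterlim_at_top_mono[OF filterlim_real_sequentially])
      (use le in \<open>auto intro!: eventually_sequentiallyI[of 1]\<close>)
  then show ?thesis by (rule filterlim_compose[OF ln_at_top])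
qed

section \<open>The finite measure condition\<close>

text \<open>
  The measure of the \<open>n\<close>-th tower is the height divided by the product of the cuts, and each
  term of the series in the definition of a rank one transformation is the measure of the spacers
  added at one stage; so the series telescopes.
\<close>

lemma spacer_measure_telescopes:
  assumes c: "\<forall>n\<ge>1. cuts T n > 1"
  shows "(\<Sum>n<N. 1 / (\<Prod>k=1..Suc n. real (cuts T k)) *
             (\<Sum>i=1..cuts T (Suc n). real (spacers T (Suc n) i)))
       = real (height T (Suc N)) / (\<Prod>k=1..N. real (cuts T k)) - 1"
proof (induction N)
  case (Suc N)
  define P where "P = (\<Prod>k=1..N. real (cuts T k))"
  have P: "P > 0" unfolding P_def by (intro prod_pos) (use c in force)
  have p: "real (cuts T (Suc N)) > 0" using c by (metis Suc_le_mono le0 One_nat_def of_nat_0_less_iff less_trans zero_less_one)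
  have S: "(\<Prod>k=1..Suc N. real (cuts T k)) = P * cuts T (Suc N)" by (simp add: P_def)
  show ?case
    unfolding sum.lessThan_Suc Suc.IH S P_def[symmetric]
    using P p by (simp add: height_Suc field_simps del: height.simps)
qed simp

text \<open>
  One stage multiplies the measure of the tower by \<open>1 + s / (p h)\<close> with \<open>s\<close> the number of
  spacers, so the measures stay bounded as soon as these relative increments are dominated by
  a summable sequence.
\<close>

lemma summable_spacer_measure:
  fixes r :: "nat \<Rightarrow> real"
  assumes c: "\<forall>n\<ge>1. cuts T n > 1" and r: "summable r" "\<And>n. r n \<ge> 0"
    and le: "\<And>n. n \<ge> N \<Longrightarrow> (\<Sum>i=1..cuts T (Suc n). real (spacers T (Suc n) i))
               \<le> r n * (cuts T (Suc n) * height T (Suc n))"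
  shows "summable (\<lambda>n. 1 / (\<Prod>k=1..Suc n. real (cuts T k)) *
                     (\<Sum>i=1..cuts T (Suc n). real (spacers T (Suc n) i)))"
proof -
  define M where "M n = real (height T (Suc n)) / (\<Prod>k=1..n. real (cuts T k))" for n
  define t where "t n = 1 / (\<Prod>k=1..Suc n. real (cuts T k)) *
                     (\<Sum>i=1..cuts T (Suc n). real (spacers T (Suc n) i))" for n
  have P: "(\<Prod>k=1..n. real (cuts T k)) > 0" for n by (intro prod_pos) (use c in force)
  have t: "t n \<ge> 0" for n unfolding t_def using P[of "Suc n"]
    by (intro mult_nonneg_nonneg sum_nonneg) simp_all
  have sum_t: "sum t {..<n} = M n - 1" for n
    unfolding t_def M_def by (rule spacer_measure_telescopes[OF c])
  have M0: "M n \<ge> 0" for n using P[of n] by (simp add: M_def del: height.simps)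
  have step: "M (Suc n) \<le> M n * exp (r n)" if "n \<ge> N" for n
  proof -
    have p: "real (cuts T (Suc n)) > 0" using c by (metis Suc_le_mono le0 One_nat_def of_nat_0_less_iff less_trans zero_less_one)
    have "t n \<le> 1 / (\<Prod>k=1..Suc n. real (cuts T k)) * (r n * (cuts T (Suc n) * height T (Suc n)))"
      unfolding t_def using P[of "Suc n"] le[OF that] by (intro mult_left_mono) simp_all
    also have "\<dots> = M n * r n" using p P[of n] by (simp add: M_def field_simps del: height.simps)
    finally have "M (Suc n) \<le> M n * (1 + r n)"
      using sum_t[of "Suc n"] sum_t[of n] by (simp add: algebra_simps)
    also have "\<dots> \<le> M n * exp (r n)" using M0[of n] by (intro mult_left_mono exp_ge_add_one_self)
    finally show ?thesis .
  qed
  have bound: "M (N + k) \<le> M N * exp (suminf r)" for k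
  proof -
    have "M (N + k) \<le> M N * exp (sum r {N..<N + k})"
    proof (induction k)
      case (Suc k)
      have "M (N + Suc k) \<le> M (N + k) * exp (r (N + k))" using step[of "N + k"] by simp
      also have "\<dots> \<le> M N * exp (sum r {N..<N + k}) * exp (r (N + k))"
        using Suc.IH by (intro mult_right_mono) simp_all
      finally show ?case by (simp add: exp_add mult.assoc)
    qed simp
    also have "sum r {N..<N + k} \<le> suminf r" using r by (intro sum_le_suminf) simp_all
    finally show ?thesis using M0[of N] by (simp add: mult_left_mono)
  qed
  have "sum t {..<n} \<le> M N * exp (suminf r) - 1" for n
  proof -
    have "sum t {..<n} \<le> sum t {..<N + n}" using t by (intro sum_mono2) auto
    then show ?thesis using bound[of n] sum_t[of "N + n"] by simp
  qed
  then have "sum t {..n} \<le> M N * exp (suminf r) - 1" for n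
    using lessThan_Suc_atMost[of n] by metis
  with t have "summable t" by (rule bounded_imp_summable)
  then show ?thesis by (simp add: t_def[abs_def])
qed

section \<open>Staircases with prescribed cuts\<close>

text \<open>Height, tower and width do not look at the map itself.\<close>

lemma height_transf_update [simp]: "height (T\<lparr>transf := f\<rparr>) n = height T n"
  by (induction T n rule: height.induct) simp_all

lemma tower_transf_update [simp]: "tower (T\<lparr>transf := f\<rparr>) n = tower T n"
proof (induction n)
  case (Suc n)
  then show ?case by (cases n) (simp_all add: Let_def)
qed simp

lemma level_transf_update [simp]:
  "left_end (T\<lparr>transf := f\<rparr>) n j = left_end T n j" "level (T\<lparr>transf := f\<rparr>) n j = level T n j"
  by (simp_all add: left_end_def level_def width_def)

text \<open>The identity is a placeholder: the map is supplied once the cuts are known to be at least \<open>2\<close>.\<close>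

definition stair :: "(nat \<Rightarrow> nat) \<Rightarrow> rank_one" where
  "stair p = \<lparr>cuts = p, spacers = (\<lambda>n i. i), transf = id\<rparr>"

lemma stair_simps [simp]: "cuts (stair p) = p" "spacers (stair p) n i = i"
  by (simp_all add: stair_def)

lemma real_sum_atLeast1AtMost: "(\<Sum>i=1..p. real i) = real p * (real p + 1) / 2"
  by (induction p) (simp_all add: field_simps)

text \<open>
  With \<open>p \<le> h powr c\<close> the spacers of one stage add the proportion \<open>(p + 1) / (2 h)\<close>, which is
  at most \<open>h powr (c - 1)\<close> and hence geometrically small, because heights at least double.
\<close>

lemma staircase_with_cuts_exists:
  assumes p: "\<forall>n\<ge>1. p n > 1" and c: "c < 1"
    and le: "\<And>n. n \<ge> N \<Longrightarrow> real (p n) \<le> real (height (stair p) n) powr c"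
  obtains S where "staircase S" "cuts S = p" "\<And>n i. spacers S n i = i" "height S = height (stair p)"
proof -
  define T where "T = stair p"
  have cT: "\<forall>n\<ge>1. cuts T n > 1" using p by (simp add: T_def)
  obtain f where f: "\<forall>n\<ge>1. \<forall>j. Suc j < height T n \<longrightarrow>
    (\<forall>x\<in>level T n j. f x = x + (left_end T n (Suc j) - left_end T n j))"
    using rank_one_transf_exists[OF cT] by blast
  define q where "q = 2 powr (c - 1)"
  have "summable (\<lambda>n. 1 / (\<Prod>k=1..Suc n. real (cuts T k)) *
                     (\<Sum>i=1..cuts T (Suc n). real (spacers T (Suc n) i)))"
  proof (rule summable_spacer_measure[OF cT])
    have "q < 1" unfolding q_def using c by (simp add: powr_less_one)
    then show "summable (\<lambda>n. q ^ n)" by (intro summable_geometric) (simp add: q_def)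
    show "q ^ n \<ge> 0" for n by (simp add: q_def)
    fix n assume n: "n \<ge> N"
    define h where "h = real (height T (Suc n))"
    have h: "2 ^ n \<le> h" unfolding h_def
      using power2_le_height[OF cT, of n] by (metis of_nat_le_iff of_nat_numeral of_nat_power)
    have h0: "h > 0" using h by (smt (verit) zero_less_power)
    define P where "P = real (p (Suc n))"
    have P1: "P > 1" using p by (simp add: P_def)
    have "P \<le> h powr c" using le[of "Suc n"] n by (simp add: P_def h_def T_def)
    also have "\<dots> = h powr (c - 1) * h" using h0 by (simp add: powr_diff)
    also have "h powr (c - 1) \<le> (2 ^ n) powr (c - 1)" using h c by (intro powr_mono2') simp_all
    also have "(2 ^ n) powr (c - 1) = q ^ n" 
      by (simp add: q_def powr_realpow[symmetric] powr_powr powr_powr_swap mult.commute)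
    finally have *: "P \<le> q ^ n * h" using h0 by simp
    have "(\<Sum>i=1..cuts T (Suc n). real (spacers T (Suc n) i)) = P * ((P + 1) / 2)"
      by (simp only: T_def stair_simps real_sum_atLeast1AtMost P_def)
    also have "\<dots> \<le> P * (q ^ n * h)"
    proof (rule mult_left_mono)
      have "(P + 1) / 2 \<le> P" using P1 by simp
      then show "(P + 1) / 2 \<le> q ^ n * h" using * by (rule order_trans)
    qed (use P1 in simp)
    finally show "(\<Sum>i=1..cuts T (Suc n). real (spacers T (Suc n) i))
               \<le> q ^ n * (cuts T (Suc n) * height T (Suc n))"
      by (simp add: P_def h_def T_def mult_ac del: height.simps)
  qed
  then have "T\<lparr>transf := f\<rparr> \<in> Rank1" unfolding Rank1_def using cT f by simp
  then show ?thesis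
    by (intro that[of "T\<lparr>transf := f\<rparr>"]) (auto simp: staircase_def T_def)
qed

section \<open>Staircases with prescribed heights\<close>

text \<open>
  The next height of a staircase at most doubles when \<open>p \<ge> 2\<close> is replaced by \<open>p + 1\<close>, so the
  largest of its values below \<open>x\<close> exceeds \<open>x/2\<close>.  The hypothesis says that the value at
  \<open>p = 2\<close> is already below \<open>x\<close>.
\<close>

lemma staircase_step_hits:
  fixes H :: nat and x :: real
  assumes H: "H \<ge> 1" and x: "2 * real H + 3 \<le> x"
  shows "\<exists>p>1. x < 2 * real (p * H + (\<Sum>i=1..p. i)) \<and> real (p * H + (\<Sum>i=1..p. i)) \<le> x"
proof -
  define F where "F p = p * H + (\<Sum>i=1..p. i)" for p
  have "{1..2::nat} = {1, 2}" by auto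
  then have F2: "F 2 = 2 * H + 3" by (simp add: F_def)
  have ge: "p \<le> F p" for p using H by (simp add: F_def trans_le_add1)
  define p where "p = (GREATEST p. real (F p) \<le> x)"
  have bd: "q \<le> nat \<lfloor>x\<rfloor>" if "real (F q) \<le> x" for q
    using ge[of q] that by (simp add: le_nat_floor)
  have start: "real (F 2) \<le> x" using x by (simp add: F2)
  have p: "real (F p) \<le> x" unfolding p_def using GreatestI_nat[where P = "\<lambda>p. real (F p) \<le> x", OF start] bd by blast
  have p2: "2 \<le> p" unfolding p_def using Greatest_le_nat[where P = "\<lambda>p. real (F p) \<le> x", OF start] bd by blast
  have "\<not> real (F (Suc p)) \<le> x"
    using Greatest_le_nat[where P = "\<lambda>p. real (F p) \<le> x" and k = "Suc p"] bd
    unfolding p_def[symmetric] by (meson Suc_n_not_le_n)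
  moreover have "F (Suc p) \<le> 2 * F p"
  proof -
    have "p \<le> (\<Sum>i=1..p. i)" using p2 by (intro member_le_sum) auto
    moreover have "p + (p - 1) \<le> (\<Sum>i=1..p. i)"
    proof -
      have "(\<Sum>i\<in>{p-1,p}. i) \<le> (\<Sum>i=1..p. i)" using p2 by (intro sum_mono2) auto
      then show ?thesis using p2 by simp
    qed
    moreover have "H \<le> p * H" using p2 by simp
    ultimately have "H + Suc p \<le> p * H + (\<Sum>i=1..p. i)" using p2 by linarith
    moreover have "F (Suc p) = F p + (H + Suc p)" by (simp add: F_def)
    ultimately show ?thesis using F_def[of p] by linarith
  qed
  ultimately show ?thesis using p p2 unfolding F_def by (intro exI[of _ p]) linarith
qed

text \<open>
  Every target is met from below, which is what keeps the next target within reach: if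
  \<open>H \<le> g n\<close>, then \<open>2 H + 3 \<le> g (n + 1)\<close>.  The first height is always \<open>1\<close>, which need not be
  close to \<open>g 1\<close>.
\<close>

lemma staircase_heights_near:
  fixes g :: "nat \<Rightarrow> real"
  assumes g1: "1 \<le> g 1" and g: "\<And>n. n \<ge> 1 \<Longrightarrow> 2 * g n + 3 \<le> g (Suc n)"
  obtains p where "\<forall>n\<ge>1. p n > (1::nat)" "\<And>n. n \<ge> 1 \<Longrightarrow> height (stair p) n \<le> g n"
    "\<And>n. n \<ge> 2 \<Longrightarrow> g n < 2 * height (stair p) n"
proof -
  define next_height where "next_height p H = p * H + (\<Sum>i=1..p. i)" for p H :: nat
  have "\<exists>H. \<forall>n. (H n \<ge> 1 \<and> real (H n) \<le> g (Suc n) \<and> (n = 0 \<longrightarrow> H n = 1)) \<and>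
      (\<exists>p>1. H (Suc n) = next_height p (H n) \<and> g (Suc (Suc n)) < 2 * real (H (Suc n)))"
  proof (rule dependent_nat_choice)
    show "\<exists>x\<ge>1. real x \<le> g (Suc 0) \<and> (0 = (0::nat) \<longrightarrow> x = 1)" using g1 by (intro exI[of _ 1]) simp
    fix x n assume *: "1 \<le> x \<and> real x \<le> g (Suc n) \<and> (n = 0 \<longrightarrow> x = 1)"
    then have "2 * real x + 3 \<le> g (Suc (Suc n))" using g[of "Suc n"] by simp
    from staircase_step_hits[OF _ this] * obtain p where p: "p > 1"
      "g (Suc (Suc n)) < 2 * real (next_height p x)" "real (next_height p x) \<le> g (Suc (Suc n))"
      unfolding next_height_def by blast
    moreover have "next_height p x \<ge> 1" using p(1) * by (simp add: next_height_def trans_le_add1)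
    ultimately show "\<exists>y. (1 \<le> y \<and> real y \<le> g (Suc (Suc n)) \<and> (Suc n = 0 \<longrightarrow> y = 1)) \<and>
      (\<exists>p>1. y = next_height p x \<and> g (Suc (Suc n)) < 2 * real y)" by blast
  qed
  then obtain H p where H: "H 0 = 1" "\<And>n. real (H n) \<le> g (Suc n)"
    and p: "\<And>n. p n > 1" "\<And>n. H (Suc n) = next_height (p n) (H n)"
    and low: "\<And>n. g (Suc (Suc n)) < 2 * real (H (Suc n))" by metis
  have eq: "height (stair (\<lambda>n. p (n - 1))) (Suc n) = H n" for n
  proof (induction n)
    case (Suc n)
    then show ?case by (simp add: height_Suc p(2) next_height_def del: height.simps)
  qed (simp add: H)
  show ?thesis
  proof (rule that[of "\<lambda>n. p (n - 1)"])
    show "\<forall>n\<ge>1. p (n - 1) > 1" using p by simp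
    show "height (stair (\<lambda>n. p (n - 1))) n \<le> g n" if "n \<ge> 1" for n
      using eq[of "n - 1"] H(2)[of "n - 1"] that by simp
    show "g n < 2 * height (stair (\<lambda>n. p (n - 1))) n" if "n \<ge> 2" for n
    proof -
      have "n = Suc (Suc (n - 2))" using that by simp
      then show ?thesis using eq[of "Suc (n - 2)"] low[of "n - 2"] by simp
    qed
  qed
qed

section \<open>Growth of heights in the class, and alternation\<close>

lemma class_CE:
  assumes "T \<in> class_C \<gamma> \<gamma>'"
  obtains n' where "n' \<ge> 1" "T \<in> Rank1" "\<forall>n\<ge>1. cuts T n > 1"
    "\<And>n. n \<ge> n' \<Longrightarrow> real (height T n) powr \<gamma> \<le> cuts T n"
    "\<And>n. n \<ge> n' \<Longrightarrow> cuts T n < real (height T n) powr \<gamma>'"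
    "\<And>n. n \<ge> n' \<Longrightarrow> \<forall>i\<in>{2..cuts T n}. spacers T n i > spacers T n (i - 1)"
    "\<And>n. n \<ge> n' \<Longrightarrow> spacers T n (cuts T n) \<le> real (height T n) powr \<gamma>'"
proof -
  from assms obtain n' where n': "n' \<ge> 1" and R: "T \<in> Rank1" and *: "\<And>n. n \<ge> n' \<Longrightarrow>
     real (cuts T n) \<in> {real (height T n) powr \<gamma> ..< real (height T n) powr \<gamma>'} \<and>
     (\<forall>i\<in>{2..cuts T n}. spacers T n i > spacers T n (i - 1)) \<and>
     real (spacers T n (cuts T n)) \<le> real (height T n) powr \<gamma>'" unfolding class_C_def by blast
  have "\<forall>n\<ge>1. cuts T n > 1" using R by (simp add: Rank1_def)
  then show ?thesis using * by (intro that[OF n' R]) simp_all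
qed

lemma class_CI:
  assumes "n' \<ge> 1" "T \<in> Rank1"
    "\<And>n. n \<ge> n' \<Longrightarrow> real (height T n) powr \<gamma> \<le> cuts T n"
    "\<And>n. n \<ge> n' \<Longrightarrow> cuts T n < real (height T n) powr \<gamma>'"
    "\<And>n. n \<ge> n' \<Longrightarrow> \<forall>i\<in>{2..cuts T n}. spacers T n i > spacers T n (i - 1)"
    "\<And>n. n \<ge> n' \<Longrightarrow> spacers T n (cuts T n) \<le> real (height T n) powr \<gamma>'"
  shows "T \<in> class_C \<gamma> \<gamma>'"
proof -
  have "\<forall>n\<ge>n'. real (cuts T n) \<in> {real (height T n) powr \<gamma> ..< real (height T n) powr \<gamma>'} \<and>
     (\<forall>i\<in>{2..cuts T n}. spacers T n i > spacers T n (i - 1)) \<and>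
     real (spacers T n (cuts T n)) \<le> real (height T n) powr \<gamma>'"
    using assms(3-6) by simp
  then show ?thesis unfolding class_C_def using assms(1,2) by blast
qed

lemma class_C_mono:
  assumes T: "T \<in> class_C \<gamma> \<gamma>'" and le: "\<beta> \<le> \<gamma>" "\<gamma>' \<le> \<beta>'"
  shows "T \<in> class_C \<beta> \<beta>'"
  using T
proof (rule class_CE)
  fix n' assume n': "n' \<ge> 1" "T \<in> Rank1" "\<forall>n\<ge>1. cuts T n > 1"
    and *: "\<And>n. n \<ge> n' \<Longrightarrow> real (height T n) powr \<gamma> \<le> cuts T n"
    "\<And>n. n \<ge> n' \<Longrightarrow> cuts T n < real (height T n) powr \<gamma>'"
    "\<And>n. n \<ge> n' \<Longrightarrow> \<forall>i\<in>{2..cuts T n}. spacers T n i > spacers T n (i - 1)"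
    "\<And>n. n \<ge> n' \<Longrightarrow> spacers T n (cuts T n) \<le> real (height T n) powr \<gamma>'"
  have h: "1 \<le> real (height T n)" if "n \<ge> n'" for n
    using height_pos[OF n'(3), of n] n'(1) that by simp
  note lo = powr_mono[OF le(1) h] and hi = powr_mono[OF le(2) h]
  show ?thesis
    by (rule class_CI[OF n'(1,2) order_trans[OF lo *(1)] less_le_trans[OF *(2) hi] *(3) order_trans[OF *(4) hi]])
qed

text \<open>
  There are at least \<open>h powr \<gamma>\<close> copies of the tower, and the spacers at most double their total
  height, because each of the \<open>p\<close> blocks of spacers is no higher than the last, hence than \<open>h\<close>.
\<close>

lemma class_C_height_growth:
  assumes T: "T \<in> class_C \<gamma> \<gamma>'" and "\<gamma>' \<le> 1"
  shows "\<forall>\<^sub>F n in sequentially.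
     (1 + \<gamma>) * ln (height T n) \<le> ln (height T (Suc n)) \<and>
     ln (height T (Suc n)) \<le> (1 + \<gamma>') * ln (height T n) + ln 2"
proof -
  obtain n' where n': "n' \<ge> 1" and "T \<in> Rank1" and c: "\<forall>n\<ge>1. cuts T n > 1"
    and *: "\<And>n. n \<ge> n' \<Longrightarrow> real (height T n) powr \<gamma> \<le> cuts T n"
    "\<And>n. n \<ge> n' \<Longrightarrow> cuts T n < real (height T n) powr \<gamma>'"
    "\<And>n. n \<ge> n' \<Longrightarrow> \<forall>i\<in>{2..cuts T n}. spacers T n i > spacers T n (i - 1)"
    "\<And>n. n \<ge> n' \<Longrightarrow> spacers T n (cuts T n) \<le> real (height T n) powr \<gamma>'"
    by (rule class_CE[OF T that])
  show ?thesis
  proof (rule eventually_sequentiallyI[of n'])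
    fix n assume n: "n \<ge> n'"
    define h p a where "h = real (height T n)" and "p = cuts T n" and "a = spacers T n"
    have n1: "n \<ge> 1" using n n' by simp
    have h: "h \<ge> 1" using height_pos[OF c n1] by (simp add: h_def)
    have p: "h powr \<gamma> \<le> real p" "real p < h powr \<gamma>'" and p1: "p > 1"
      and inc: "\<And>i. 2 \<le> i \<Longrightarrow> i \<le> p \<Longrightarrow> a (i - 1) < a i" and ap: "real (a p) \<le> h powr \<gamma>'"
      using *(1,2,4)[OF n] bspec[OF *(3)[OF n]] c n1 unfolding h_def p_def a_def by simp_all
    have a_le: "a i \<le> a p" if "1 \<le> i" "i \<le> p" for i
      using that(2,1)
    proof (induction rule: inc_induct)
      case (step k)
      then show ?case using inc[of "Suc k"] by simp
    qed simp
    have "h powr \<gamma>' \<le> h" using powr_mono[OF \<open>\<gamma>' \<le> 1\<close> h] h by simp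
    with ap have ap: "real (a p) \<le> h" by simp
    have "(\<Sum>i=1..p. real (a i)) \<le> (\<Sum>i=1..p. h)"
      using a_le ap by (intro sum_mono) (meson atLeastAtMost_iff of_nat_le_iff order_trans)
    then have sum: "(\<Sum>i=1..p. real (a i)) \<le> real p * h" by simp
    have eq: "real (height T (Suc n)) = real p * h + (\<Sum>i=1..p. real (a i))"
      by (simp add: height_Suc[OF n1] h_def p_def a_def)
    have pos: "real p * h > 0" using p1 h by simp
    have sum0: "(\<Sum>i=1..p. real (a i)) \<ge> 0" by (intro sum_nonneg) simp
    have lp: "\<gamma> * ln h \<le> ln p" "ln p \<le> \<gamma>' * ln h"
      using p p1 h ln_mono[of "h powr \<gamma>" "real p"] ln_mono[of "real p" "h powr \<gamma>'"] by (auto simp: ln_powr)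
    have lph: "ln (real p * h) = ln p + ln h" using p1 h by (simp add: ln_mult)
    have "ln (real p * h) \<le> ln (height T (Suc n))" using eq sum0 pos by (intro ln_mono) simp_all
    moreover have "ln (height T (Suc n)) \<le> ln (2 * (real p * h))"
      unfolding eq using sum sum0 pos by (intro ln_mono) linarith+
    then have "ln (height T (Suc n)) \<le> ln 2 + ln (real p * h)" using pos ln_mult_pos[of 2 "real p * h"] by linarith
    ultimately show "(1 + \<gamma>) * ln (height T n) \<le> ln (height T (Suc n)) \<and>
        ln (height T (Suc n)) \<le> (1 + \<gamma>') * ln (height T n) + ln 2"
      using lp lph by (simp add: h_def[symmetric] algebra_simps del: height.simps)
  qed
qed

lemma alternating_if_interlaced:
  assumes inc: "increasing_pos a" "increasing_pos b" and \<delta>: "\<delta> > 0" and N: "N \<ge> 1"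
    and ab: "\<And>n. n \<ge> N \<Longrightarrow> real (a (n + d)) powr (1 + \<delta>) < real (b n)"
    and ba: "\<And>n. n \<ge> N \<Longrightarrow> real (b n) powr (1 + \<delta>) < real (a (Suc (n + d)))"
  shows "alternating \<delta> a b"
proof -
  have less: "x < y" if "real x powr (1 + \<delta>) < real y" "0 < x" for x y :: nat
  proof -
    have "real x powr 1 \<le> real x powr (1 + \<delta>)" using that(2) \<delta> by (intro powr_mono) simp_all
    then show ?thesis using that by simp
  qed
  have pos: "0 < a n" "0 < b n" if "n \<ge> 1" for n using inc that by (auto simp: increasing_pos_def)
  have ab': "a (n + d) < b n" and ba': "b n < a (Suc (n + d))" if "n \<ge> N" for n
    using less[OF ab[OF that]] less[OF ba[OF that]] pos that N by simp_all
  have "alternating_to b a \<delta>" unfolding alternating_to_def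
  proof (intro conjI inc, rule exI[of _ N], intro conjI allI impI N)
    fix n assume n: "n \<ge> N"
    show "\<exists>m\<ge>1. a m \<le> b n \<and> b n < a (m + 1) \<and> real (a m) powr (1 + \<delta>) < real (b n) \<and>
        real (b n) powr (1 + \<delta>) < real (a (m + 1))"
      using ab[OF n] ba[OF n] ab'[OF n] ba'[OF n] n N by (intro exI[of _ "n + d"]) simp
  qed
  moreover have "alternating_to a b \<delta>" unfolding alternating_to_def
  proof (intro conjI inc, rule exI[of _ "Suc (N + d)"], intro conjI allI impI)
    fix n assume n: "n \<ge> Suc (N + d)"
    define m where "m = n - d - 1"
    have m: "m \<ge> N" "n = Suc (m + d)" using n by (auto simp: m_def)
    show "\<exists>m\<ge>1. b m \<le> a n \<and> a n < b (m + 1) \<and> real (b m) powr (1 + \<delta>) < real (a n) \<and>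
        real (a n) powr (1 + \<delta>) < real (b (m + 1))"
      using ab[of "Suc m"] ba[of m] ab'[of "Suc m"] ba'[of m] m N by (intro exI[of _ m]) simp
  qed simp
  ultimately show ?thesis by (simp add: alternating_def)
qed

text \<open>
  With \<open>x, y, z\<close> the logarithms of three successive heights, \<open>(x + y) / 2\<close> and \<open>(y + z) / 2\<close> are
  those of the geometric means of neighbours, and the terms \<open>ln 2\<close> pay for meeting these means
  from below only up to a factor \<open>2\<close>.  The first two estimates will bound the number of cuts; they
  hold because \<open>\<gamma> (x + y) \<le> z - x \<le> \<gamma>' (x + y) + 2 ln 2\<close>, while they ask only for the rates \<open>\<gamma>/3\<close>
  and \<open>3 \<gamma>'\<close>.  The last two will give the alternation; they hold because the mean is half of
  \<open>y - x \<ge> \<gamma> x\<close> away from either neighbour.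
\<close>

lemma geometric_mean_estimates:
  fixes x y z \<gamma> \<gamma>' :: real
  assumes \<gamma>: "0 < \<gamma>" "\<gamma> < \<gamma>'" "\<gamma>' < 1/3"
    and xy: "(1 + \<gamma>) * x \<le> y" "y \<le> (1 + \<gamma>') * x + ln 2"
    and yz: "(1 + \<gamma>) * y \<le> z" "z \<le> (1 + \<gamma>') * y + ln 2"
    and large: "6 \<le> \<gamma> * x"
  shows "(y + z) / 2 - (x + y) / 2 + ln 2 \<le> 3 * \<gamma>' * ((x + y) / 2 - ln 2)"
    and "\<gamma> / 3 * ((x + y) / 2) \<le> (y + z) / 2 - (x + y) / 2 - 2 * ln 2"
    and "(1 + \<gamma> / 4) * x < (x + y) / 2 - ln 2"
    and "(1 + \<gamma> / 4) * ((x + y) / 2) < y"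
proof -
  have l2: "0 < ln (2::real)" "ln (2::real) < 1" using ln_2_less_1 by simp_all
  have x: "x > 0" using large \<gamma> by (smt (verit) mult_nonneg_nonpos)
  have "\<gamma> * x > 0" using \<gamma> x by simp
  then have yx: "x \<le> y" using xy by (simp add: algebra_simps)
  define X Y X' Y' e where "X = \<gamma> * x" and "Y = \<gamma> * y" and "X' = \<gamma>' * x" and "Y' = \<gamma>' * y"
    and "e = \<gamma>' * ln 2"
  note prods = X_def Y_def X'_def Y'_def e_def
  have m: "6 \<le> X" "X \<le> X'" "X \<le> Y" "X' \<le> Y'" "e \<le> ln 2"
    using \<gamma> x yx large l2 by (simp_all add: prods)
  have lin: "x + X \<le> y" "y \<le> x + X' + ln 2" "y + Y \<le> z" "z \<le> y + Y' + ln 2"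
    using xy yz by (simp_all add: prods algebra_simps)
  have "3 * \<gamma>' * ((x + y) / 2 - ln 2) = 3/2 * X' + 3/2 * Y' - 3 * e"
    by (simp add: prods field_simps)
  moreover have "(y + z) / 2 - (x + y) / 2 + ln 2 \<le> 3/2 * X' + 3/2 * Y' - 3 * e"
    using lin m l2 by argo
  ultimately show "(y + z) / 2 - (x + y) / 2 + ln 2 \<le> 3 * \<gamma>' * ((x + y) / 2 - ln 2)" by metis
  have "\<gamma> / 3 * ((x + y) / 2) = 1/6 * X + 1/6 * Y" by (simp add: prods field_simps)
  moreover have "1/6 * X + 1/6 * Y \<le> (y + z) / 2 - (x + y) / 2 - 2 * ln 2"
    using lin m l2 by argo
  ultimately show "\<gamma> / 3 * ((x + y) / 2) \<le> (y + z) / 2 - (x + y) / 2 - 2 * ln 2" by metis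
  have "(1 + \<gamma> / 4) * x = x + 1/4 * X" by (simp add: prods field_simps)
  moreover have "x + 1/4 * X < (x + y) / 2 - ln 2" using lin m l2 by argo
  ultimately show "(1 + \<gamma> / 4) * x < (x + y) / 2 - ln 2" by metis
  \<comment> \<open>the last claim amounts to \<open>\<gamma> (x + y) < 4 (y - x)\<close>, where \<open>y - x \<ge> \<gamma> x\<close>\<close>
  have "\<gamma> * y < 3 * \<gamma> * x"
  proof -
    have "X' \<le> 1/3 * x" unfolding X'_def using \<gamma> x by (intro mult_right_mono) simp_all
    moreover have "1 < x" using mult_strict_right_mono[of \<gamma> 1 x] \<gamma> x large by linarith
    ultimately have "y < 3 * x" using lin(2) l2 by argo
    then show ?thesis using \<gamma> by simp
  qed
  then show "(1 + \<gamma> / 4) * ((x + y) / 2) < y"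
    using xy by (simp add: field_simps)
qed

text \<open>
  The next height \<open>p h + p (p + 1) / 2\<close> lies between \<open>p h\<close> and \<open>2 p h\<close>, the latter because the upper
  bound on the heights already forces \<open>p \<le> h\<close>.
\<close>

lemma stair_cuts_bounds:
  fixes p :: "nat \<Rightarrow> nat" and b c :: real
  defines "H \<equiv> \<lambda>n. real (height (stair p) n)"
  assumes p: "\<forall>n\<ge>1. p n > 1" and n: "n \<ge> 1" and c: "c \<le> 1"
    and up: "ln (H (Suc n)) < (1 + c) * ln (H n)"
    and low: "(1 + b) * ln (H n) + ln 2 \<le> ln (H (Suc n))"
  shows "real (p n) < H n powr c" and "H n powr b \<le> real (p n)"
proof -
  define h P where "h = H n" and "P = real (p n)"
  have h: "h \<ge> 1" using height_pos[of "stair p" n] p n by (simp add: h_def H_def)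
  have P: "P > 1" using p n by (simp add: P_def)
  have pos: "P > 0" "h > 0" using P h by simp_all
  have eq: "H (Suc n) = P * h + P * (P + 1) / 2"
    using real_sum_atLeast1AtMost[of "p n"] by (simp add: H_def h_def P_def height_Suc[OF n])
  have lnPh: "ln (P * h) = ln P + ln h" using P h by (simp add: ln_mult)
  have "P * h \<le> H (Suc n)" unfolding eq using P by simp
  then have "ln (P * h) \<le> ln (H (Suc n))" using P h by (intro ln_mono) simp_all
  then have "ln P < c * ln h" using up lnPh by (simp add: h_def algebra_simps)
  then have "exp (ln P) < exp (c * ln h)" by (simp only: exp_less_cancel_iff)
  also have "exp (ln P) = P" using pos(1) by (rule exp_ln)
  finally show "real (p n) < H n powr c" using pos(2) by (simp add: powr_def P_def h_def)
  moreover have "h powr c \<le> h" using powr_mono[OF c h] h by simp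
  ultimately have "P \<le> h" by (simp add: P_def h_def)
  then have "(P + 1) / 2 \<le> h" using h by simp
  then have "P * ((P + 1) / 2) \<le> P * h" using P by (intro mult_left_mono) simp_all
  then have "H (Suc n) \<le> 2 * (P * h)" unfolding eq by simp
  moreover have "P * h > 0" using P h by simp
  moreover have "H (Suc n) > 0" unfolding eq using P h by (intro add_pos_pos) simp_all
  ultimately have "ln (H (Suc n)) \<le> ln 2 + ln (P * h)"
    using ln_mono[of "H (Suc n)" "2 * (P * h)"] ln_mult_pos[of 2 "P * h"] by linarith
  then have "b * ln h \<le> ln P" using low lnPh by (simp add: h_def algebra_simps)
  then have "exp (b * ln h) \<le> exp (ln P)" by (simp only: exp_le_cancel_iff)
  also have "exp (ln P) = P" using pos(1) by (rule exp_ln)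
  finally show "H n powr b \<le> real (p n)" using pos(2) by (simp add: powr_def P_def h_def)
qed

lemma powr_less_if_ln:
  fixes x y a :: real
  assumes "a * ln x < ln y" "0 < x" "0 < y"
  shows "x powr a < y"
proof -
  have "exp (a * ln x) < exp (ln y)" using assms(1) by (simp only: exp_less_cancel_iff)
  then show ?thesis using assms(2,3) by (simp add: powr_def)
qed

theorem lemma1p2:
  fixes \<gamma> \<gamma>' :: real and T :: rank_one
  assumes "0 < \<gamma>" and "\<gamma> < \<gamma>'" and "\<gamma>' < 1/3"
    and "T \<in> class_C \<gamma> \<gamma>'"
  shows "\<exists>S. staircase S \<and> S \<in> class_C (\<gamma>/3) (3 * \<gamma>')
           \<and> (T, S) \<in> class_L (\<gamma>/3) (3 * \<gamma>') (\<gamma>/4)"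
proof -
  have cT: "\<forall>n\<ge>1. cuts T n > 1" using assms(4) by (rule class_CE)
  define L where "L n = ln (real (height T n))" for n
  define G where "G n = (L n + L (Suc n)) / 2" for n
  have "\<forall>\<^sub>F n in sequentially. 6 / \<gamma> \<le> L n"
    using filterlim_ln_height[OF cT] unfolding L_def filterlim_at_top by blast
  moreover have growth: "\<forall>\<^sub>F n in sequentially. (1 + \<gamma>) * L n \<le> L (Suc n) \<and>
      L (Suc n) \<le> (1 + \<gamma>') * L n + ln 2"
    unfolding L_def using assms by (intro class_C_height_growth) simp_all
  moreover have "\<forall>\<^sub>F n in sequentially. (1 + \<gamma>) * L (Suc n) \<le> L (Suc (Suc n)) \<and>
      L (Suc (Suc n)) \<le> (1 + \<gamma>') * L (Suc n) + ln 2"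
    using growth by (rule eventually_sequentially_Suc[THEN iffD2])
  ultimately have "\<forall>\<^sub>F n in sequentially.
      G (Suc n) - G n + ln 2 \<le> 3 * \<gamma>' * (G n - ln 2) \<and> \<gamma> / 3 * G n \<le> G (Suc n) - G n - 2 * ln 2 \<and>
      (1 + \<gamma> / 4) * L n < G n - ln 2 \<and> (1 + \<gamma> / 4) * G n < L (Suc n)"
  proof eventually_elim
    case (elim n)
    then have "6 \<le> \<gamma> * L n" using assms(1) by (simp add: field_simps)
    then show ?case unfolding G_def
      using geometric_mean_estimates[OF assms(1-3), of "L n" "L (Suc n)" "L (Suc (Suc n))"] elim
      by blast
  qed
  then obtain d where d: "\<And>n. n \<ge> d \<Longrightarrow> G (Suc n) - G n + ln 2 \<le> 3 * \<gamma>' * (G n - ln 2)"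
    "\<And>n. n \<ge> d \<Longrightarrow> \<gamma> / 3 * G n \<le> G (Suc n) - G n - 2 * ln 2"
    "\<And>n. n \<ge> d \<Longrightarrow> (1 + \<gamma> / 4) * L n < G n - ln 2"
    "\<And>n. n \<ge> d \<Longrightarrow> (1 + \<gamma> / 4) * G n < L (Suc n)"
    unfolding eventually_sequentially by blast
  have L0: "0 \<le> L n" if "n \<ge> 1" for n
    using height_pos[OF cT that] by (simp add: L_def)
  have G0: "0 \<le> G n" if "n \<ge> 1" for n using L0 that by (simp add: G_def)
  have start: "1 \<le> exp (G (1 + d))" using G0[of "1 + d"] by simp
  have doubling: "2 * exp (G (n + d)) + 3 \<le> exp (G (Suc n + d))" if n: "n \<ge> 1" for n
  proof -
    have "0 \<le> (1 + \<gamma> / 4) * L (n + d)" using L0[of "n + d"] n assms(1) by simp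
    then have "ln 2 \<le> G (n + d)" using d(3)[of "n + d"] by simp
    then have "exp (ln 2) \<le> exp (G (n + d))" by (simp only: exp_le_cancel_iff)
    then have two: "2 \<le> exp (G (n + d))" by simp
    have "0 \<le> \<gamma> / 3 * G (n + d)" using G0[of "n + d"] n assms(1) by simp
    then have "ln 2 + (ln 2 + G (n + d)) \<le> G (Suc n + d)" using d(2)[of "n + d"] by simp
    then have "exp (ln 2 + (ln 2 + G (n + d))) \<le> exp (G (Suc n + d))"
      by (simp only: exp_le_cancel_iff)
    also have "exp (ln 2 + (ln 2 + G (n + d))) = 4 * exp (G (n + d))" unfolding exp_add by simp
    finally show ?thesis using two by simp
  qed
  \<comment> \<open>\<open>height (stair p) n\<close> stands between \<open>height T (n + d)\<close> and \<open>height T (n + d + 1)\<close>, for \<open>n \<ge> 2\<close>\<close>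
  obtain p where p: "\<forall>n\<ge>1. p n > 1"
    and up: "\<And>n. n \<ge> 1 \<Longrightarrow> height (stair p) n \<le> exp (G (n + d))"
    and low: "\<And>n. n \<ge> 2 \<Longrightarrow> exp (G (n + d)) < 2 * height (stair p) n"
    using staircase_heights_near[of "\<lambda>n. exp (G (n + d))", OF start doubling] by blast
  define H where "H n = real (height (stair p) n)" for n
  have H: "1 \<le> H n" if "n \<ge> 1" for n
    using height_pos[of "stair p" n] p that by (simp add: H_def)
  have lnH: "ln (H n) \<le> G (n + d)" "G (n + d) - ln 2 < ln (H n)" if "n \<ge> 2" for n
  proof -
    have "ln (H n) \<le> ln (exp (G (n + d)))" using up[of n] H[of n] that unfolding H_def by (intro ln_mono) simp_all
    then show "ln (H n) \<le> G (n + d)" by simp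
    have "ln (exp (G (n + d))) < ln (2 * H n)" using low[of n] that unfolding H_def
      by (intro ln_less_cancel_iff[THEN iffD2]) (simp_all add: order.strict_trans1[OF less_imp_le[OF exp_gt_zero]])
    then show "G (n + d) - ln 2 < ln (H n)" using H[of n] that by (simp add: ln_mult)
  qed
  have cuts: "real (p n) < H n powr (3 * \<gamma>')" "H n powr (\<gamma> / 3) \<le> real (p n)" if "n \<ge> 2" for n
  proof -
    have ge: "n + d \<ge> d" "n \<ge> 1" "Suc n \<ge> 2" using that by simp_all
    have "3 * \<gamma>' * (G (n + d) - ln 2) \<le> 3 * \<gamma>' * ln (H n)"
      using lnH(2)[OF that] assms by (intro mult_left_mono) simp_all
    then have 1: "ln (H (Suc n)) < (1 + 3 * \<gamma>') * ln (H n)"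
      using d(1)[OF ge(1)] lnH(1)[OF ge(3)] lnH(2)[OF that] by (simp add: distrib_right)
    have "\<gamma> / 3 * ln (H n) \<le> \<gamma> / 3 * G (n + d)"
      using lnH(1)[OF that] assms by (intro mult_left_mono) simp_all
    then have 2: "(1 + \<gamma> / 3) * ln (H n) + ln 2 \<le> ln (H (Suc n))"
      using d(2)[OF ge(1)] lnH(2)[OF ge(3)] lnH(1)[OF that] by (simp add: distrib_right)
    show "real (p n) < H n powr (3 * \<gamma>')" "H n powr (\<gamma> / 3) \<le> real (p n)"
      using stair_cuts_bounds[OF p ge(2) _ 1[unfolded H_def] 2[unfolded H_def]] assms(3)
      by (simp_all add: H_def)
  qed
  obtain S where S: "staircase S" "cuts S = p" "\<And>n i. spacers S n i = i" "height S = height (stair p)"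
    using staircase_with_cuts_exists[OF p, of "3 * \<gamma>'" 2] cuts(1) assms(3) 
    unfolding H_def by (metis less_imp_le mult.commute pos_less_divide_eq zero_less_numeral)
  have SC: "S \<in> class_C (\<gamma> / 3) (3 * \<gamma>')"
  proof (rule class_CI[of 2])
    show "S \<in> Rank1" using S(1) by (simp add: staircase_def)
  qed (use cuts S(2-4) in \<open>auto simp: H_def less_imp_le\<close>)
  have "alternating (\<gamma> / 4) (height T) (height S)"
  proof (rule alternating_if_interlaced[where N = 2 and d = d])
    show "increasing_pos (height T)" "increasing_pos (height S)"
      using cT p S(2) by (simp_all add: increasing_pos_height)
    fix n :: nat assume n: "n \<ge> 2"
    have pos: "0 < H n" "0 < real (height T (n + d))" "0 < real (height T (Suc (n + d)))"
      using H[of n] height_pos[OF cT, of "n + d"] height_pos[OF cT, of "Suc (n + d)"] n by simp_all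
    have "(1 + \<gamma> / 4) * L (n + d) < ln (H n)" using d(3)[of "n + d"] lnH(2)[OF n] by simp
    then show "real (height T (n + d)) powr (1 + \<gamma> / 4) < real (height S n)"
      using powr_less_if_ln pos by (simp add: S(4) H_def L_def)
    have "(1 + \<gamma> / 4) * ln (H n) \<le> (1 + \<gamma> / 4) * G (n + d)"
      using lnH(1)[OF n] assms(1) by (intro mult_left_mono) simp_all
    then have "(1 + \<gamma> / 4) * ln (H n) < L (Suc (n + d))" using d(4)[of "n + d"] by simp
    then show "real (height S n) powr (1 + \<gamma> / 4) < real (height T (Suc (n + d)))"
      using powr_less_if_ln pos by (simp add: S(4) H_def L_def)
  qed (use assms in simp_all)
  moreover have "T \<in> class_C (\<gamma> / 3) (3 * \<gamma>')"
    using assms by (intro class_C_mono[OF assms(4)]) simp_all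
  ultimately show ?thesis using S(1) SC by (auto simp: class_L_def)
qed

end
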